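(* There exists a maximal eventually different family $\mathcal{A}\subseteq\omega^\omega$ such that $\mathcal{A}$ is not $s$-measurable, not $l$-measurable and not $m$-measurable, and such that there is a dominating subfamily $\mathcal{D}\subseteq\mathcal{A}$ with $|\mathcal{D}|\le\mathfrak{d}$.
   Context: Two functions $f,g\in\omega^\omega$ are eventually different (e.d.) if $f\cap g$ is a finite subset of $\omega\times\omega$, i.e. $f(n)=g(n)$ for only finitely many $n$. A family $\mathcal{A}\subseteq\omega^\omega$ is an e.d. family if any two distinct members are eventually different; it is a maximal eventually different (m.e.d.) family if it is an e.d. family that is maximal with respect to inclusion among e.d. families. A family $\mathcal{F}\subseteq\omega^\omega$ is dominating if for every $x\in\omega^\omega$ there is $f\in\mathcal{F}$ with $x(n)<f(n)$ for all but finitely many $n$; $\mathfrak{d}$ is the least cardinality of a dominating family. A tree on $\omega$ is a nonempty set $T\subseteq\omega^{<\omega}$ closed under initial segments; $[T]=\{x\in\omega^\omega:(\forall n)\ x\restriction n\in T\}$ is its body; for $t\in T$, $succ(t)=\{a\in\omega: t^\frown a\in T\}$; $stem(T)$ is the node $\tau\in T$ such that $|succ(\tau)|>1$ and $|succ(s)|=1$ for each $s\subsetneq\tau$. $T$ is a Sacks (perfect) tree, $T\in\mathbb{S}$, if every $s\in T$ has an extension $t\in T$, $s\subseteq t$, with $|succ(t)|\ge 2$; a Miller tree, $T\in\mathbb{M}$, if every $s\in T$ has an extension $t\in T$, $s\subseteq t$, with $|succ(t)|=\aleph_0$; a Laver tree, $T\in\mathbb{L}$, if $|succ(t)|=\aleph_0$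 for every $t\in T$ with $t\supseteq stem(T)$. For a family of trees $\mathbb{T}$, a set $A\subseteq\omega^\omega$ is $t$-measurable if for every $P\in\mathbb{T}$ there is $Q\in\mathbb{T}$ with $Q\subseteq P$ and ($[Q]\subseteq A$ or $[Q]\cap A=\emptyset$). The notions of $s$-, $m$-, $l$-measurability correspond to $\mathbb{T}=\mathbb{S},\mathbb{M},\mathbb{L}$ respectively. *)

theory Defs
  imports Main "HOL-Library.Sublist"
begin

unbundle cardinal_syntax

definition eventually_different :: "(nat \<Rightarrow> nat) \<Rightarrow> (nat \<Rightarrow> nat) \<Rightarrow> bool" where
  "eventually_different f g \<longleftrightarrow> finite {n. f n = g n}"

definition ed_family :: "(nat \<Rightarrow> nat) set \<Rightarrow> bool" where
  "ed_family A \<longleftrightarrow> (\<forall>f\<in>A. \<forall>g\<in>A. f \<noteq> g \<longrightarrow> eventually_different f g)"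

definition med_family :: "(nat \<Rightarrow> nat) set \<Rightarrow> bool" where
  "med_family A \<longleftrightarrow> ed_family A \<and> (\<forall>B. ed_family B \<and> A \<subseteq> B \<longrightarrow> B = A)"

definition dominating :: "(nat \<Rightarrow> nat) set \<Rightarrow> bool" where
  "dominating F \<longleftrightarrow> (\<forall>x. \<exists>f\<in>F. \<forall>\<^sub>\<infinity>n. x n < f n)"

text \<open>Cardinals are represented by cardinal orders, which are unique only up to order
  isomorphism; hence the least cardinality of a dominating family is obtained by choosing a
  representative. Existence is proved in \<open>dominating_number\<close> below.\<close>

definition dominating_number :: "(nat \<Rightarrow> nat) rel" where
  "dominating_number =
     (SOME r. (\<exists>F. dominating F \<and> r = |F| ) \<and> (\<forall>F. dominating F \<longrightarrow> r \<le>o |F| ))"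

lemma dominating_UNIV: "dominating UNIV"
  unfolding dominating_def
proof
  fix x :: "nat \<Rightarrow> nat"
  have "\<forall>\<^sub>\<infinity>n. x n < Suc (x n)" by simp
  then show "\<exists>f\<in>UNIV. \<forall>\<^sub>\<infinity>n. x n < f n" by (intro bexI[of _ "\<lambda>n. Suc (x n)"]) auto
qed

lemma dominating_number:
  shows "\<exists>F. dominating F \<and> dominating_number = |F|"
    and "dominating F \<Longrightarrow> dominating_number \<le>o |F|"
proof -
  let ?R = "card_of ` {F. dominating F}"
  have "?R \<noteq> {}" using dominating_UNIV by blast
  moreover have "\<forall>r\<in>?R. Card_order r" by (auto simp: card_of_Card_order)
  ultimately obtain r where "r \<in> ?R" "\<forall>r'\<in>?R. r \<le>o r'"
    using exists_minim_Card_order[of ?R] by blast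
  then have "(\<exists>F. dominating F \<and> r = |F| ) \<and> (\<forall>F. dominating F \<longrightarrow> r \<le>o |F| )" by auto
  then have *: "(\<exists>F. dominating F \<and> dominating_number = |F| ) \<and>
      (\<forall>F. dominating F \<longrightarrow> dominating_number \<le>o |F| )"
    unfolding dominating_number_def by (rule someI)
  show "\<exists>F. dominating F \<and> dominating_number = |F|" using * by blast
  show "dominating F \<Longrightarrow> dominating_number \<le>o |F|" using * by blast
qed

definition is_tree :: "nat list set \<Rightarrow> bool" where
  "is_tree T \<longleftrightarrow> T \<noteq> {} \<and> (\<forall>t\<in>T. \<forall>s. prefix s t \<longrightarrow> s \<in> T)"

definition body :: "nat list set \<Rightarrow> (nat \<Rightarrow> nat) set" where
  "body T = {x. \<forall>n. map x [0..<n] \<in> T}"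

definition succs :: "nat list set \<Rightarrow> nat list \<Rightarrow> nat set" where
  "succs T t = {a. t @ [a] \<in> T}"

text \<open>At least two successors, possibly infinitely many; \<^const>\<open>card\<close> is not used because it is
  \<open>0\<close> on infinite sets.\<close>

definition splits :: "nat list set \<Rightarrow> nat list \<Rightarrow> bool" where
  "splits T t \<longleftrightarrow> (\<exists>a\<in>succs T t. \<exists>b\<in>succs T t. a \<noteq> b)"

definition is_stem :: "nat list set \<Rightarrow> nat list \<Rightarrow> bool" where
  "is_stem T u \<longleftrightarrow> u \<in> T \<and> splits T u \<and> (\<forall>s. strict_prefix s u \<longrightarrow> card (succs T s) = 1)"

definition Sacks :: "nat list set set" where
  "Sacks = {T. is_tree T \<and> (\<forall>s\<in>T. \<exists>t\<in>T. prefix s t \<and> splits T t)}"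

definition Miller :: "nat list set set" where
  "Miller = {T. is_tree T \<and> (\<forall>s\<in>T. \<exists>t\<in>T. prefix s t \<and> infinite (succs T t))}"

text \<open>A Laver tree is required to have a stem, so that trees without a splitting node
  do not qualify vacuously.\<close>

definition Laver :: "nat list set set" where
  "Laver = {T. is_tree T \<and>
     (\<exists>u. is_stem T u \<and> (\<forall>t\<in>T. prefix u t \<longrightarrow> infinite (succs T t)))}"

lemma is_stem_unique:
  assumes "is_tree T" "is_stem T u" "is_stem T v"
  shows "u = v"
proof -
  have not_below: "\<not> strict_prefix p q" if "is_stem T p" "is_stem T q" for p q
  proof
    assume "strict_prefix p q"
    then have "card (succs T p) = 1" using that(2) by (auto simp: is_stem_def)
    then show False using that(1) by (auto simp: is_stem_def splits_def card_1_singleton_iff)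
  qed
  have "\<not> parallel u v"
  proof
    assume "parallel u v"
    then obtain as b bs c cs where *: "b \<noteq> c" "u = as @ b # bs" "v = as @ c # cs"
      using parallel_decomp by blast
    then have "prefix (as @ [b]) u" "prefix (as @ [c]) v" "strict_prefix as u"
      by (auto simp: strict_prefix_def)
    then have "b \<in> succs T as" "c \<in> succs T as" "card (succs T as) = 1"
      using assms unfolding is_stem_def is_tree_def succs_def by blast+
    then show False using *(1) by (auto simp: card_1_singleton_iff)
  qed
  then have "prefix u v \<or> prefix v u" by (auto simp: parallel_def)
  then show ?thesis using not_below[OF assms(2,3)] not_below[OF assms(3,2)]
    by (auto simp: strict_prefix_def)
qed

definition measurable_wrt :: "nat list set set \<Rightarrow> (nat \<Rightarrow> nat) set \<Rightarrow> bool" where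
  "measurable_wrt \<T> A \<longleftrightarrow>
     (\<forall>P\<in>\<T>. \<exists>Q\<in>\<T>. Q \<subseteq> P \<and> (body Q \<subseteq> A \<or> body Q \<inter> A = {}))"

end

theory Submission
  imports Defs "HOL-Library.Nat_Bijection"
begin

text \<open>
  A single Laver tree \<open>P\<close> refutes all three kinds of measurability. Every Laver tree is Miller
  and every Miller tree is Sacks, so it suffices that for every perfect \<open>Q \<subseteq> P\<close> the family
  meets the body of \<open>Q\<close> without containing it.

  Functions are made eventually different by letting them remember their past: \<open>stamp k f\<close>
  stores at place \<open>n\<close> the restriction of \<open>f\<close> to \<open>n + 1\<close> together with a colour \<open>k n\<close> among three.
  For \<open>f \<noteq> g\<close> the functions \<open>stamp k f\<close> and \<open>stamp l g\<close> are eventually different whatever the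
  colourings \<open>k\<close> and \<open>l\<close> are (\<open>stamp_eventually_different\<close>), whereas two stamps of the same \<open>f\<close>
  agree exactly where the colourings do. The stamps with constant colour 0 form the body of
  a Laver tree \<open>P\<close> (\<open>body_stamp_tree\<close>, \<open>stamp_tree_Laver\<close>).

  Let \<open>B\<close> be a Bernstein set for perfect trees (\<open>Bernstein_set_Sacks\<close>). The family receives
  the branches of \<open>P\<close> that lie in \<open>B\<close>. Each other branch of \<open>P\<close> must stay outside
  even after a maximal extension; to block it, the family receives the same function recoloured
  by 1 at the odd places, which agrees with the branch at all even places. So a
  branch of \<open>P\<close> belongs to an m.e.d. extension exactly if it lies in \<open>B\<close>. Finally, the
  stamps with constant colour 2 of a dominating family of least cardinality are again dominating,
  and their colour keeps them disjoint from everything chosen before; they join the family as well.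
  Zorn's lemma (\<open>med_family_extension\<close>) completes it to an m.e.d. family.
\<close>

section \<open>A Bernstein set for perfect trees\<close>

text \<open>Well-order the index set in its least order type. Fewer than \<open>|J|\<close> points have been used
  before stage \<open>j\<close>, so they cannot exhaust \<open>X j\<close>, and a fresh point can be picked.\<close>

lemma distinct_representatives:
  fixes X :: "'i \<Rightarrow> 'a set"
  assumes "\<And>j. j \<in> J \<Longrightarrow> |J| \<le>o |X j|"
  obtains h where "inj_on h J" "\<And>j. j \<in> J \<Longrightarrow> h j \<in> X j"
proof -
  have wo: "Well_order |J|" and card: "Card_order |J|"
    by (simp_all add: card_of_Well_order card_of_Card_order)
  then have wf: "wf ( |J| - Id)" by (simp add: well_order_on_def)
  define h where
    "h = wfrec ( |J| - Id) (\<lambda>h j. SOME x. x \<in> X j \<and> x \<notin> h ` {i. (i, j) \<in> |J| - Id})"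
  have h_rec: "h j = (SOME x. x \<in> X j \<and> x \<notin> h ` {i. (i, j) \<in> |J| - Id})" for j
  proof -
    have "cut h ( |J| - Id) j ` {i. (i, j) \<in> |J| - Id} = h ` {i. (i, j) \<in> |J| - Id}"
      by (rule image_cong) (auto simp: cut_apply)
    then show ?thesis
      unfolding h_def by (subst wfrec[OF wf]) (simp add: h_def)
  qed
  have h: "h j \<in> X j \<and> h j \<notin> h ` {i. (i, j) \<in> |J| - Id}" if "j \<in> J" for j
  proof -
    have "{i. (i, j) \<in> |J| - Id} = underS |J| j" by (auto simp: underS_def)
    then have "|h ` {i. (i, j) \<in> |J| - Id}| <o |J|"
      using card_of_underS[OF card] that card_of_image ordLeq_ordLess_trans
      by (metis Field_card_of)
    then have "|h ` {i. (i, j) \<in> |J| - Id}| <o |X j|"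
      using assms[OF that] by (rule ordLess_ordLeq_trans)
    then have "\<not> X j \<subseteq> h ` {i. (i, j) \<in> |J| - Id}"
      using card_of_mono1 not_ordLess_ordLeq by blast
    then have "\<exists>x. x \<in> X j \<and> x \<notin> h ` {i. (i, j) \<in> |J| - Id}" by blast
    then show ?thesis unfolding h_rec[of j] by (rule someI_ex)
  qed
  have "inj_on h J"
  proof (rule inj_onI, rule ccontr)
    fix i j assume *: "i \<in> J" "j \<in> J" "h i = h j" "i \<noteq> j"
    have "total_on J |J|"
      using wo by (metis Field_card_of well_order_on_def linear_order_on_def)
    then have "(i, j) \<in> |J| - Id \<or> (j, i) \<in> |J| - Id"
      using * by (auto simp: total_on_def)
    then show False using * h[of i] h[of j] by (metis (mono_tags) image_eqI mem_Collect_eq)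
  qed
  with h show ?thesis using that by blast
qed

text \<open>Each step lengthens the node, so entry \<open>i\<close> of the limit can be read off from node \<open>i + 1\<close>.
  The length bound serves to place every finite part of the limit below some node.\<close>

lemma limit_of_nodes:
  fixes node :: "nat \<Rightarrow> nat list"
  assumes "\<And>n. strict_prefix (node n) (node (Suc n))"
  obtains x where "\<And>n. node n = map x [0..<length (node n)]" "\<And>n. n \<le> length (node n)"
proof -
  have long: "n \<le> length (node n)" for n
  proof (induction n)
    case (Suc n)
    then show ?case using prefix_length_less[OF assms[of n]] by simp
  qed simp
  have mono: "prefix (node m) (node n)" if "m \<le> n" for m n
    using that
  proof (induction n rule: dec_induct)
    case (step n)
    then show ?case using assms[of n] by (metis prefix_order.dual_order.trans strict_prefix_def)
  qed simp
  define x where "x i = node (Suc i) ! i" for i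
  have "node n ! i = x i" if "i < length (node n)" for i n
  proof -
    have "i < length (node (Suc i))" using long[of "Suc i"] by simp
    then show ?thesis
      unfolding x_def using mono[of n "Suc i"] mono[of "Suc i" n] that
      by (metis nat_le_linear nth_append prefix_def)
  qed
  then have "node n = map x [0..<length (node n)]" for n
    by (intro nth_equalityI) auto
  then show ?thesis using that long by blast
qed

text \<open>The Cantor scheme: a 0-1 sequence tells at each splitting node which of two incompatible
  extensions to follow, and different sequences lead to different branches.\<close>

lemma continuum_le_body_Sacks:
  assumes "T \<in> Sacks"
  shows "|UNIV :: (nat \<Rightarrow> bool) set| \<le>o |body T|"
proof -
  have closed: "s \<in> T" if "t \<in> T" "prefix s t" for s t
    using assms that by (auto simp: Sacks_def is_tree_def)
  have root: "[] \<in> T" using assms by (auto simp: Sacks_def is_tree_def)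
  have "\<exists>p. \<forall>b. p b \<in> T \<and> strict_prefix s (p b) \<and> p True \<parallel> p False" if s: "s \<in> T" for s
  proof -
    obtain t a b where t: "t \<in> T" "prefix s t" "t @ [a] \<in> T" "t @ [b] \<in> T" "a \<noteq> b"
      using assms s by (auto simp: Sacks_def splits_def succs_def)
    have "strict_prefix s (t @ [c])" for c
      using t(2) by (auto simp: prefix_def strict_prefix_def)
    moreover have "t @ [a] \<parallel> t @ [b]" using t(5) by (simp add: parallel_def)
    ultimately show ?thesis
      using t by (intro exI[of _ "\<lambda>c. if c then t @ [a] else t @ [b]"]) auto
  qed
  then obtain p where p: "p s b \<in> T" "strict_prefix s (p s b)" "p s True \<parallel> p s False"
    if "s \<in> T" for s b
    by metis
  define node where "node c = rec_nat [] (\<lambda>n s. p s (c n))" for c :: "nat \<Rightarrow> bool"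
  have node_0: "node c 0 = []" and node_Suc: "node c (Suc n) = p (node c n) (c n)" for c n
    by (simp_all add: node_def)
  have node_T: "node c n \<in> T" for c n
    by (induction n) (simp_all add: node_0 node_Suc root p)
  have "\<exists>x. \<forall>n. node c n = map x [0..<length (node c n)] \<and> n \<le> length (node c n)" for c
  proof -
    have "strict_prefix (node c n) (node c (Suc n))" for n
      using p(2)[OF node_T] by (simp add: node_Suc)
    then show ?thesis by (rule limit_of_nodes[of "node c"]) blast
  qed
  then obtain x where x: "\<And>c n. node c n = map (x c) [0..<length (node c n)]"
    and long: "\<And>c n. n \<le> length (node c n)"
    by metis
  have "x c \<in> body T" for c
    unfolding body_def
  proof (intro CollectI allI)
    fix n
    have "map (x c) [0..<n] = take n (map (x c) [0..<length (node c n)])"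
      using long[of n c] by (simp add: take_map)
    then have "map (x c) [0..<n] = take n (node c n)" by (simp flip: x)
    then show "map (x c) [0..<n] \<in> T"
      using closed[OF node_T] take_is_prefix by metis
  qed
  moreover have "inj x"
  proof (rule injI, rule ccontr)
    fix c d assume eq: "x c = x d" and "c \<noteq> d"
    then have ex: "\<exists>n. c n \<noteq> d n" by auto
    \<comment> \<open>At the first disagreement both sequences sit at the same node and leave it in incompatible
      directions, although both nodes they reach lie on one branch.\<close>
    define n where "n = (LEAST n. c n \<noteq> d n)"
    have n: "c n \<noteq> d n" using LeastI_ex[OF ex] by (simp add: n_def)
    have below: "c i = d i" if "i < n" for i
      using not_less_Least that by (auto simp: n_def)
    have "node c i = node d i" if "i \<le> n" for i
      using that below by (induction i) (auto simp: node_0 node_Suc)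
    then have "node c n = node d n" by simp
    then have "node c (Suc n) \<parallel> node d (Suc n)"
      using n p(3)[OF node_T[of c n]] by (cases "c n") (auto simp: node_Suc parallel_commute)
    moreover have "prefix (map (x c) [0..<i]) (map (x c) [0..<j])" if "i \<le> j" for i j
      using that by (metis map_append prefix_def le_add_diff_inverse upt_add_eq_append zero_le)
    then have "\<not> node c (Suc n) \<parallel> node d (Suc n)"
      using x[of c "Suc n"] x[of d "Suc n"] eq by (metis nat_le_linear parallel_def)
    ultimately show False by contradiction
  qed
  ultimately show ?thesis using card_of_ordLeq[of UNIV "body T"] by blast
qed

text \<open>There are at most continuum many trees and each perfect body has continuum many branches,
  so two representatives can be chosen from each body, all of them distinct. The first
  ones form \<open>B\<close>, and the second ones witness that no perfect body is contained in it.\<close>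

lemma Bernstein_set_Sacks:
  obtains B where "\<And>T. T \<in> Sacks \<Longrightarrow> body T \<inter> B \<noteq> {}" "\<And>T. T \<in> Sacks \<Longrightarrow> \<not> body T \<subseteq> B"
proof -
  define J :: "(nat list set \<times> bool) set" where "J = Sacks \<times> UNIV"
  define code :: "nat list set \<times> bool \<Rightarrow> nat \<Rightarrow> bool" where
    "code j n = (if n = 0 then snd j else list_decode (n - 1) \<in> fst j)" for j n
  have "inj code"
  proof (rule injI)
    fix j k assume eq: "code j = code k"
    have "snd j = snd k" using fun_cong[OF eq, of 0] by (simp add: code_def)
    moreover have "s \<in> fst j \<longleftrightarrow> s \<in> fst k" for s
      using fun_cong[OF eq, of "Suc (list_encode s)"] by (simp add: code_def)
    ultimately show "j = k" by (auto intro: prod_eqI)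
  qed
  then have J: "|J| \<le>o |UNIV :: (nat \<Rightarrow> bool) set|"
    using card_of_ordLeq[of J UNIV] by (meson inj_on_subset subset_UNIV)
  have "|J| \<le>o |body (fst j)|" if "j \<in> J" for j
    using ordLeq_transitive[OF J continuum_le_body_Sacks] that by (auto simp: J_def)
  then obtain h where h: "inj_on h J" "\<And>j. j \<in> J \<Longrightarrow> h j \<in> body (fst j)"
    using distinct_representatives[of J "\<lambda>j. body (fst j)"] by blast
  define B where "B = h ` (Sacks \<times> {True})"
  have "body T \<inter> B \<noteq> {}" if "T \<in> Sacks" for T
    using h(2)[of "(T, True)"] that by (auto simp: B_def J_def)
  moreover have "\<not> body T \<subseteq> B" if "T \<in> Sacks" for T
  proof -
    have "h (T, False) \<in> body T" using h(2)[of "(T, False)"] that by (auto simp: J_def)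
    moreover have "h (T, False) \<notin> B"
      using h(1) that by (auto simp: B_def J_def dest!: inj_onD)
    ultimately show ?thesis by blast
  qed
  ultimately show ?thesis using that by blast
qed

section \<open>Laver trees, Miller trees and Sacks trees\<close>

lemma infinite_succs_splits:
  assumes "infinite (succs T t)"
  shows "splits T t"
proof -
  obtain a where a: "a \<in> succs T t" using infinite_imp_nonempty[OF assms] by blast
  moreover obtain b where "b \<in> succs T t - {a}"
    using infinite_imp_nonempty[OF infinite_remove[OF assms]] by blast
  ultimately show ?thesis by (auto simp: splits_def)
qed

lemma Miller_subset_Sacks: "Miller \<subseteq> Sacks"
  using infinite_succs_splits unfolding Miller_def Sacks_def by blast

text \<open>A node of a Laver tree is comparable with the stem, because nothing can branch off below the
  stem. So either the node itself or the stem above it splits infinitely.\<close>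

lemma Laver_subset_Miller: "Laver \<subseteq> Miller"
proof
  fix T assume "T \<in> Laver"
  then obtain u where tree: "is_tree T" and u: "is_stem T u"
    and inf: "\<And>t. t \<in> T \<Longrightarrow> prefix u t \<Longrightarrow> infinite (succs T t)"
    by (auto simp: Laver_def)
  have uT: "u \<in> T" using u by (simp add: is_stem_def)
  have "\<exists>t\<in>T. prefix s t \<and> infinite (succs T t)" if s: "s \<in> T" for s
  proof -
    have "\<not> s \<parallel> u"
    proof
      assume "s \<parallel> u"
      then obtain as b bs c cs where *: "b \<noteq> c" "s = as @ b # bs" "u = as @ c # cs"
        using parallel_decomp by blast
      then have "prefix (as @ [b]) s" "prefix (as @ [c]) u" "strict_prefix as u"
        by (auto simp: strict_prefix_def)
      then have "b \<in> succs T as" "c \<in> succs T as" "card (succs T as) = 1"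
        using tree u uT s unfolding is_stem_def is_tree_def succs_def by blast+
      then show False using *(1) by (auto simp: card_1_singleton_iff)
    qed
    then have "prefix s u \<or> prefix u s" by (auto simp: parallel_def)
    then show ?thesis using inf s uT by blast
  qed
  then show "T \<in> Miller" using tree by (simp add: Miller_def)
qed

lemma not_measurable_wrt:
  assumes "P \<in> \<T>" "\<T> \<subseteq> Sacks"
    and "\<And>Q. Q \<in> Sacks \<Longrightarrow> Q \<subseteq> P \<Longrightarrow> body Q \<inter> A \<noteq> {} \<and> \<not> body Q \<subseteq> A"
  shows "\<not> measurable_wrt \<T> A"
  using assms unfolding measurable_wrt_def by (metis subsetD)

section \<open>Eventually different functions that remember their past\<close>

text \<open>The remainder modulo 3 holds the colour and the quotient codes \<open>f \<restriction> (n + 1)\<close>. The last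
  value is kept outside the list code because a pair code bounds its first component, which gives
  \<open>f n \<le> stamp k f n\<close>.\<close>

definition stamp :: "(nat \<Rightarrow> nat) \<Rightarrow> (nat \<Rightarrow> nat) \<Rightarrow> nat \<Rightarrow> nat" where
  "stamp k f n = 3 * prod_encode (f n, list_encode (map f [0..<n])) + k n mod 3"

lemma stamp_eqD:
  assumes "stamp k f n = stamp l g n"
  shows "k n mod 3 = l n mod 3" "i \<le> n \<Longrightarrow> f i = g i"
proof -
  have mod: "stamp k f n mod 3 = k n mod 3" "stamp l g n mod 3 = l n mod 3"
    and div: "stamp k f n div 3 = prod_encode (f n, list_encode (map f [0..<n]))"
      "stamp l g n div 3 = prod_encode (g n, list_encode (map g [0..<n]))"
    by (simp_all add: stamp_def)
  show "k n mod 3 = l n mod 3" using mod assms by simp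
  have "prod_encode (f n, list_encode (map f [0..<n])) = prod_encode (g n, list_encode (map g [0..<n]))"
    using div assms by simp
  then have "f n = g n" "map f [0..<n] = map g [0..<n]"
    by (simp_all add: list_encode_eq)
  then show "i \<le> n \<Longrightarrow> f i = g i" by (cases "i = n") auto
qed

lemma le_stamp: "f n \<le> stamp k f n"
  using le_prod_encode_1[of "f n" "list_encode (map f [0..<n])"] by (simp add: stamp_def)

lemma stamp_cong: "(\<And>i. i \<le> n \<Longrightarrow> f i = g i) \<Longrightarrow> stamp k f n = stamp k g n"
  by (auto simp: stamp_def intro!: arg_cong[of _ _ list_encode])

lemma stamp_eventually_different:
  assumes "f \<noteq> g"
  shows "eventually_different (stamp k f) (stamp l g)"
proof -
  obtain i where "f i \<noteq> g i" using assms by blast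
  then have "n < i" if "stamp k f n = stamp l g n" for n
    using stamp_eqD(2)[OF that, of i] by (cases "n < i") auto
  then have "{n. stamp k f n = stamp l g n} \<subseteq> {..<i}" by blast
  then show ?thesis unfolding eventually_different_def using finite_subset by blast
qed

definition stamp_tree :: "(nat \<Rightarrow> nat) \<Rightarrow> nat list set" where
  "stamp_tree k = {map (stamp k f) [0..<n] | f n. True}"

text \<open>The value \<open>x n\<close> of a branch determines the stamped function up to \<open>n\<close>, so the functions
  approximating \<open>x\<close> cohere and their diagonal is stamped to \<open>x\<close>.\<close>

lemma body_stamp_tree: "body (stamp_tree k) = range (stamp k)"
proof
  show "range (stamp k) \<subseteq> body (stamp_tree k)" by (auto simp: body_def stamp_tree_def)
  show "body (stamp_tree k) \<subseteq> range (stamp k)"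
  proof
    fix x assume "x \<in> body (stamp_tree k)"
    then have x_in: "map x [0..<n] \<in> stamp_tree k" for n by (simp add: body_def)
    have "\<exists>f. map x [0..<n] = map (stamp k f) [0..<n]" for n
    proof -
      obtain f m where "map x [0..<n] = map (stamp k f) [0..<m]"
        using x_in[of n] unfolding stamp_tree_def by blast
      moreover from this have "n = m" using map_eq_imp_length_eq by fastforce
      ultimately show ?thesis by blast
    qed
    then obtain f where f: "\<And>n. map x [0..<n] = map (stamp k (f n)) [0..<n]" by metis
    have x: "x i = stamp k (f n) i" if "i < n" for i n
      using f[of n] that by auto
    define g where "g i = f (Suc i) i" for i
    have "g i = f (Suc n) i" if "i \<le> n" for i n
    proof -
      have "stamp k (f (Suc i)) i = stamp k (f (Suc n)) i"
        using x[of i "Suc i"] x[of i "Suc n"] that by simp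
      then show ?thesis unfolding g_def by (rule stamp_eqD(2)) simp
    qed
    then have "x n = stamp k g n" for n
      using x[of n "Suc n"] stamp_cong[of n g "f (Suc n)" k] by simp
    then show "x \<in> range (stamp k)" by blast
  qed
qed

text \<open>The next value of \<open>f\<close> is free at every node and is recorded in the stamp, so every
  node splits infinitely and the root is the stem.\<close>

lemma stamp_tree_Laver: "stamp_tree k \<in> Laver"
proof -
  have inf: "infinite (succs (stamp_tree k) t)" if t_in: "t \<in> stamp_tree k" for t
  proof -
    obtain f n where t: "t = map (stamp k f) [0..<n]" using t_in unfolding stamp_tree_def by blast
    define v where "v a = stamp k (f(n := a)) n" for a
    have "t @ [v a] = map (stamp k (f(n := a))) [0..<Suc n]" for a
      by (auto simp: t v_def intro!: stamp_cong)
    then have "t @ [v a] \<in> stamp_tree k" for a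
      unfolding stamp_tree_def by blast
    then have "range v \<subseteq> succs (stamp_tree k) t" by (auto simp: succs_def)
    moreover have "inj v"
      by (rule injI) (use stamp_eqD(2) in \<open>fastforce simp: v_def\<close>)
    ultimately show ?thesis using infinite_super infinite_UNIV_nat finite_imageD by metis
  qed
  have nil: "[] \<in> stamp_tree k" by (auto simp: stamp_tree_def intro: exI[of _ 0])
  have "is_tree (stamp_tree k)"
  proof -
    have "s \<in> stamp_tree k" if "prefix s (map (stamp k f) [0..<n])" for s f n
    proof -
      have "length s \<le> n" using prefix_length_le[OF that] by simp
      then have "take (length s) (map (stamp k f) [0..<n]) = map (stamp k f) [0..<length s]"
        by (simp add: take_map)
      moreover have "take (length s) (map (stamp k f) [0..<n]) = s"
        using that by (auto simp: prefix_def)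
      ultimately have "s = map (stamp k f) [0..<length s]" by argo
      then show ?thesis unfolding stamp_tree_def by blast
    qed
    then show ?thesis using nil by (auto simp: is_tree_def stamp_tree_def)
  qed
  moreover have "splits (stamp_tree k) []"
    using infinite_succs_splits inf[OF nil] by blast
  ultimately show ?thesis using inf nil by (auto simp: Laver_def is_stem_def)
qed

section \<open>The maximal eventually different family\<close>

lemma med_family_extension:
  assumes "ed_family A"
  obtains M where "med_family M" "A \<subseteq> M"
proof -
  have "\<exists>M\<in>{M. ed_family M \<and> A \<subseteq> M}. \<forall>X\<in>{M. ed_family M \<and> A \<subseteq> M}. M \<subseteq> X \<longrightarrow> X = M"
  proof (rule subset_Zorn_nonempty)
    show "{M. ed_family M \<and> A \<subseteq> M} \<noteq> {}" using assms by blast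
    fix C assume C: "C \<noteq> {}" "subset.chain {M. ed_family M \<and> A \<subseteq> M} C"
    have "eventually_different f g" if fg: "f \<in> \<Union>C" "g \<in> \<Union>C" "f \<noteq> g" for f g
    proof -
      obtain X Y where X: "X \<in> C" "f \<in> X" and Y: "Y \<in> C" "g \<in> Y" using fg by auto
      moreover have "X \<subseteq> Y \<or> Y \<subseteq> X"
        using C(2) X(1) Y(1) unfolding subset_chain_def by blast
      ultimately have "\<exists>Z\<in>C. f \<in> Z \<and> g \<in> Z" by blast
      moreover have "ed_family Z" if "Z \<in> C" for Z
        using C(2) that unfolding subset_chain_def by blast
      ultimately show ?thesis using fg(3) unfolding ed_family_def by blast
    qed
    moreover have "A \<subseteq> \<Union>C" using C unfolding subset_chain_def by blast
    ultimately show "\<Union>C \<in> {M. ed_family M \<and> A \<subseteq> M}" by (simp add: ed_family_def)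
  qed
  then obtain M where M: "ed_family M" "A \<subseteq> M"
    and max: "\<And>X. ed_family X \<Longrightarrow> A \<subseteq> X \<Longrightarrow> M \<subseteq> X \<Longrightarrow> X = M"
    by auto
  have "med_family M"
    unfolding med_family_def
  proof (intro conjI allI impI)
    fix X assume "ed_family X \<and> M \<subseteq> X"
    then show "X = M" using max[of X] M(2) by (meson subset_trans)
  qed (fact M(1))
  then show ?thesis using that M(2) by blast
qed

theorem theorem29:
  shows "\<exists>\<A> :: (nat \<Rightarrow> nat) set.
           med_family \<A> \<and>
           \<not> measurable_wrt Sacks \<A> \<and>
           \<not> measurable_wrt Laver \<A> \<and>
           \<not> measurable_wrt Miller \<A> \<and>
           (\<exists>\<D> \<subseteq> \<A>. dominating \<D> \<and> |\<D>| \<le>o dominating_number)"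
proof -
  obtain B where B: "\<And>T. T \<in> Sacks \<Longrightarrow> body T \<inter> B \<noteq> {}" "\<And>T. T \<in> Sacks \<Longrightarrow> \<not> body T \<subseteq> B"
    using Bernstein_set_Sacks by blast
  obtain F where F: "dominating F" "dominating_number = |F|" using dominating_number(1) by blast
  let ?c = "stamp (\<lambda>n. 0)" and ?p = "stamp (\<lambda>n. n mod 2)" and ?d = "stamp (\<lambda>n. 2)"
  define D where "D = ?d ` F"
  \<comment> \<open>A branch of \<open>P\<close> outside \<open>B\<close> is replaced by a copy that agrees with it at the even places only.\<close>
  define \<kappa> :: "(nat \<Rightarrow> nat) \<Rightarrow> nat \<Rightarrow> nat" where
    "\<kappa> f = (if ?c f \<in> B then (\<lambda>n. 0) else (\<lambda>n. n mod 2))" for f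
  define A where "A = range (\<lambda>f. stamp (\<kappa> f) f) \<union> D"
  have d: "eventually_different (stamp k f) (?d g)" "eventually_different (?d g) (stamp k f)"
    if "\<And>n. k n < 2" for k f g
  proof -
    have "k n mod 3 \<noteq> 2" for n using that[of n] by simp
    then have "stamp k f n \<noteq> ?d g n" for n using stamp_eqD(1)[of k f n "\<lambda>n. 2" g] by auto
    then have "{n. stamp k f n = ?d g n} = {}" "{n. ?d g n = stamp k f n} = {}"
      by (auto dest: sym)
    then show "eventually_different (stamp k f) (?d g)" "eventually_different (?d g) (stamp k f)"
      by (simp_all add: eventually_different_def)
  qed
  have "ed_family A"
    unfolding ed_family_def
  proof (intro ballI impI)
    fix a b assume ab: "a \<in> A" "b \<in> A" "a \<noteq> b"
    have \<kappa>: "\<kappa> f n < 2" for f n by (simp add: \<kappa>_def)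
    have "(\<exists>f. a = stamp (\<kappa> f) f) \<or> (\<exists>f. a = ?d f)" "(\<exists>g. b = stamp (\<kappa> g) g) \<or> (\<exists>g. b = ?d g)"
      using ab(1,2) by (auto simp: A_def D_def)
    then consider f g where "a = stamp (\<kappa> f) f" "b = stamp (\<kappa> g) g"
      | f g where "a = stamp (\<kappa> f) f" "b = ?d g"
      | f g where "a = ?d f" "b = stamp (\<kappa> g) g"
      | f g where "a = ?d f" "b = ?d g"
      by blast
    then show "eventually_different a b"
    proof cases
      case (1 f g)
      then have "f \<noteq> g" using ab(3) by blast
      then show ?thesis unfolding 1 by (rule stamp_eventually_different)
    next
      case (2 f g)
      show ?thesis unfolding 2 using \<kappa> by (rule d(1))
    next
      case (3 f g)
      show ?thesis unfolding 3 using \<kappa> by (rule d(2))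
    next
      case (4 f g)
      then have "f \<noteq> g" using ab(3) by blast
      then show ?thesis unfolding 4 by (rule stamp_eventually_different)
    qed
  qed
  then obtain M where M: "med_family M" "A \<subseteq> M" using med_family_extension by blast
  then have in_M: "stamp (\<kappa> f) f \<in> M" for f by (auto simp: A_def)
  have only_B: "?c f \<in> B" if "?c f \<in> M" for f
  proof (rule ccontr)
    assume "?c f \<notin> B"
    then have "stamp (\<kappa> f) f = ?p f" by (simp add: \<kappa>_def)
    then have "?p f \<in> M" using in_M[of f] by simp
    moreover have "?c f 1 \<noteq> ?p f 1" by (simp add: stamp_def)
    then have "?c f \<noteq> ?p f" by metis
    moreover have "ed_family M" using M(1) by (simp add: med_family_def)
    ultimately have "finite {n. ?c f n = ?p f n}"
      using that unfolding ed_family_def eventually_different_def by blast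
    moreover have "range (\<lambda>n. 2 * n) \<subseteq> {n. ?c f n = ?p f n}" by (auto simp: stamp_def)
    ultimately have "finite (range (\<lambda>n::nat. 2 * n))" by (rule rev_finite_subset)
    then show False by (auto dest: finite_imageD simp: inj_on_def)
  qed
  let ?P = "stamp_tree (\<lambda>n. 0)"
  have split: "body Q \<inter> M \<noteq> {} \<and> \<not> body Q \<subseteq> M" if Q: "Q \<in> Sacks" "Q \<subseteq> ?P" for Q
  proof -
    have "body Q \<subseteq> body ?P" using Q(2) unfolding body_def by blast
    then have "body Q \<subseteq> range ?c" by (simp only: body_stamp_tree)
    moreover have "?c f \<in> M" if "?c f \<in> B" for f
      using in_M[of f] that by (simp add: \<kappa>_def)
    ultimately have "body Q \<inter> M = body Q \<inter> B" using only_B by blast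
    then show ?thesis using B[OF Q(1)] by blast
  qed
  have "dominating D"
    unfolding dominating_def
  proof
    fix x
    obtain f where f: "f \<in> F" "\<forall>\<^sub>\<infinity>n. x n < f n" using F(1) by (auto simp: dominating_def)
    have "\<forall>\<^sub>\<infinity>n. x n < ?d f n"
      using f(2) by (rule eventually_mono) (rule less_le_trans[OF _ le_stamp])
    then show "\<exists>g\<in>D. \<forall>\<^sub>\<infinity>n. x n < g n" using f(1) by (auto simp: D_def)
  qed
  moreover have "D \<subseteq> M" using M(2) by (auto simp: A_def)
  moreover have "|D| \<le>o dominating_number" unfolding F(2) D_def by (rule card_of_image)
  moreover have "?P \<in> Laver" "?P \<in> Miller" "?P \<in> Sacks"
    using stamp_tree_Laver Laver_subset_Miller Miller_subset_Sacks by blast+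
  moreover have "Laver \<subseteq> Sacks" using Laver_subset_Miller Miller_subset_Sacks by (rule order_trans)
  moreover have "\<not> measurable_wrt \<T> M" if "?P \<in> \<T>" "\<T> \<subseteq> Sacks" for \<T>
    using that split by (rule not_measurable_wrt)
  ultimately show ?thesis
    using M(1) Miller_subset_Sacks by (intro exI[of _ M] exI[of _ D] conjI) simp_all
qed

end
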